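(* For every integer $n \ge 2$, every induced subgraph of the $n$-dimensional hypercube $Q_n$ that has a unique perfect matching has at most $2^{n-1}$ vertices.
   Context: The $n$-dimensional hypercube $Q_n$ has vertex set $\{0,1\}^n$, two vertices being adjacent iff they differ in exactly one coordinate. *)

theory Defs
  imports "Graph_Theory.Digraph_Component"
begin

definition hypercube :: "nat \<Rightarrow> (bool list, bool list \<times> bool list) pre_digraph" where
  "hypercube n =
    \<lparr> verts = {v. length v = n},
      arcs = {(u, v). length u = n \<and> length v = n \<and> card {i. i < n \<and> u ! i \<noteq> v ! i} = 1},
      tail = fst, head = snd \<rparr>"

lemma graph_hypercube: "graph (hypercube n)"
proof -
  have fin: "finite {v :: bool list. length v = n}"
    using finite_lists_length_eq[of "UNIV :: bool set" n] by simp
  have "arcs (hypercube n) \<subseteq> {v. length v = n} \<times> {v. length v = n}"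
    by (auto simp: hypercube_def)
  then have "finite (arcs (hypercube n))"
    using fin by (meson finite_SigmaI finite_subset)
  moreover have "symmetric (hypercube n)"
  proof -
    have "(v, u) \<in> arcs (hypercube n)" if "(u, v) \<in> arcs (hypercube n)" for u v
    proof -
      have "{i. i < n \<and> v ! i \<noteq> u ! i} = {i. i < n \<and> u ! i \<noteq> v ! i}"
        by blast
      then show ?thesis
        using that unfolding hypercube_def by simp
    qed
    moreover have "arcs_ends (hypercube n) = arcs (hypercube n)"
      by (simp add: arcs_ends_conv hypercube_def)
    ultimately show ?thesis
      by (auto simp: symmetric_def intro: symI)
  qed
  moreover have "finite (verts (hypercube n))"
    using fin by (simp add: hypercube_def)
  moreover have "fst e \<in> verts (hypercube n) \<and> snd e \<in> verts (hypercube n) \<and> fst e \<noteq> snd e"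
    if "e \<in> arcs (hypercube n)" for e
  proof -
    obtain u v where e: "e = (u, v)"
      by (cases e)
    have "length u = n" "length v = n" "card {i. i < n \<and> u ! i \<noteq> v ! i} = 1"
      using that unfolding e hypercube_def by simp_all
    moreover from this(3) have "u \<noteq> v"
      by (intro notI) simp
    ultimately show ?thesis
      unfolding e hypercube_def by simp
  qed
  moreover have "tail (hypercube n) = fst" "head (hypercube n) = snd"
    by (simp_all add: hypercube_def)
  ultimately show ?thesis
    by unfold_locales (simp_all only: arc_to_ends_def prod_eq_iff fst_conv snd_conv simp_thms)
qed

text \<open>
  A graph is a symmetric digraph here, so an undirected edge corresponds to two opposite arcs.
  Matchings consist of undirected edges, represented by their sets of end vertices.
\<close>

definition edges :: "('a, 'b) pre_digraph \<Rightarrow> 'a set set" where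
  "edges G = {{u, v} | u v. u \<rightarrow>\<^bsub>G\<^esub> v}"

definition matching :: "('a, 'b) pre_digraph \<Rightarrow> 'a set set \<Rightarrow> bool" where
  "matching G M \<longleftrightarrow> M \<subseteq> edges G \<and> pairwise disjnt M"

definition perfect_matching :: "('a, 'b) pre_digraph \<Rightarrow> 'a set set \<Rightarrow> bool" where
  "perfect_matching G M \<longleftrightarrow> matching G M \<and> (\<forall>v \<in> verts G. \<exists>e \<in> M. v \<in> e)"

end

theory Submission
  imports Defs
begin

text \<open>
  Give the edges of the cube in direction \<open>i\<close> a nonzero weight \<open>w i\<close> in a field of
  characteristic 2, and let \<open>A\<close> be the weighted adjacency operator. Every 4-cycle contributes an
  even number of equal terms to \<open>A\<^sup>2\<close>, so \<open>A\<^sup>2 = (\<Sum>i. (w i)\<^sup>2) I\<close>, and weights can be chosen in the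
  field with four elements (but not in the one with two, if \<open>n\<close> is odd) so that \<open>A\<^sup>2 = 0\<close>. If an
  induced subgraph on the vertex set \<open>S\<close> has a unique perfect matching, then the principal
  submatrix of \<open>A\<close> on \<open>S\<close> is nonsingular. Hence \<open>f + A g = 0\<close> with \<open>f\<close>, \<open>g\<close> supported on \<open>S\<close>
  forces \<open>A f = 0\<close>, so \<open>f = 0\<close> and then \<open>g = 0\<close>: the map \<open>(f, g) \<mapsto> f + A g\<close> is injective, and
  counting over the finite field gives \<open>2 |S| \<le> 2 ^ n\<close>.
\<close>

subsection \<open>The field with four elements\<close>

text \<open>\<open>Omega4\<close> and \<open>Omega4'\<close> are the two primitive cube roots of
  unity: each is the square of the other, and they add up to \<open>One4\<close>.\<close>

datatype F4 = Zero4 | One4 | Omega4 | Omega4'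

instantiation F4 :: comm_ring_1
begin

definition zero_F4 :: F4 where "zero_F4 = Zero4"
definition one_F4 :: F4 where "one_F4 = One4"
definition uminus_F4 :: "F4 \<Rightarrow> F4" where "uminus_F4 x = x"

fun plus_F4 :: "F4 \<Rightarrow> F4 \<Rightarrow> F4" where
  "plus_F4 Zero4 y = y"
| "plus_F4 x Zero4 = x"
| "plus_F4 One4 Omega4 = Omega4'"
| "plus_F4 Omega4 One4 = Omega4'"
| "plus_F4 One4 Omega4' = Omega4"
| "plus_F4 Omega4' One4 = Omega4"
| "plus_F4 Omega4 Omega4' = One4"
| "plus_F4 Omega4' Omega4 = One4"
| "plus_F4 One4 One4 = Zero4"
| "plus_F4 Omega4 Omega4 = Zero4"
| "plus_F4 Omega4' Omega4' = Zero4"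

definition minus_F4 :: "F4 \<Rightarrow> F4 \<Rightarrow> F4" where "minus_F4 x y = x + y"

fun times_F4 :: "F4 \<Rightarrow> F4 \<Rightarrow> F4" where
  "times_F4 Zero4 y = Zero4"
| "times_F4 x Zero4 = Zero4"
| "times_F4 One4 y = y"
| "times_F4 x One4 = x"
| "times_F4 Omega4 Omega4 = Omega4'"
| "times_F4 Omega4 Omega4' = One4"
| "times_F4 Omega4' Omega4 = One4"
| "times_F4 Omega4' Omega4' = Omega4"

instance
proof
  fix a b c :: F4
  show "a + b + c = a + (b + c)" by (cases a; cases b; cases c) simp_all
  show "a + b = b + a" by (cases a; cases b) simp_all
  show "0 + a = a" by (simp add: zero_F4_def)
  show "- a + a = 0" by (cases a) (simp_all add: zero_F4_def uminus_F4_def)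
  show "a - b = a + - b" by (simp add: minus_F4_def uminus_F4_def)
  show "a * b * c = a * (b * c)" by (cases a; cases b; cases c) simp_all
  show "a * b = b * a" by (cases a; cases b) simp_all
  show "1 * a = a" by (cases a) (simp_all add: one_F4_def)
  show "(a + b) * c = a * c + b * c" by (cases a; cases b; cases c) simp_all
  show "(0::F4) \<noteq> 1" by (simp add: zero_F4_def one_F4_def)
qed

end

instance F4 :: idom
proof
  fix a b :: F4
  assume "a \<noteq> 0" "b \<noteq> 0"
  then show "a * b \<noteq> 0" by (cases a; cases b) (simp_all add: zero_F4_def)
qed

lemma UNIV_F4: "(UNIV :: F4 set) = {Zero4, One4, Omega4, Omega4'}"
  using F4.exhaust by auto

instance F4 :: finite
  by standard (simp add: UNIV_F4)

lemma card_UNIV_F4: "card (UNIV :: F4 set) = 4"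
  by (simp add: UNIV_F4)

lemma F4_add_self: "x + x = (0::F4)"
  by (cases x) (simp_all add: zero_F4_def)

lemma F4_of_nat_even: "even k \<Longrightarrow> of_nat k = (0::F4)"
  by (elim evenE) (simp add: mult_2 F4_add_self)

lemma F4_weights_exist:
  assumes "n \<ge> 2"
  obtains w :: "nat \<Rightarrow> F4" where "\<And>i. w i \<noteq> 0" "(\<Sum>i<n. w i * w i) = 0"
proof (cases "even n")
  case True
  then show ?thesis
    by (intro that[of "\<lambda>_. 1"]) (simp_all add: F4_of_nat_even)
next
  case False
  with assms obtain k where k: "n = Suc (Suc k)" "odd k"
    by (metis One_nat_def Suc_1 Suc_le_D Suc_le_mono even_Suc)
  \<comment> \<open>Squaring swaps \<open>Omega4\<close> and \<open>Omega4'\<close>, and their sum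
    is 1. With the remaining \<open>k\<close> weights equal to 1 the total is \<open>Suc k\<close>
    ones, an even number.\<close>
  define w where "w i = (if i = 0 then Omega4 else if i = 1 then Omega4' else 1)" for i :: nat
  have "(\<Sum>i<n. w i * w i) = Omega4' + (Omega4 + of_nat k)"
    by (simp add: k(1) sum.lessThan_Suc_shift w_def del: sum.lessThan_Suc)
  also have "\<dots> = of_nat (Suc k)"
    by (simp add: one_F4_def flip: add.assoc)
  also have "\<dots> = 0"
    using k(2) by (intro F4_of_nat_even) simp
  finally show ?thesis
    by (intro that[of w]) (simp_all add: w_def zero_F4_def one_F4_def)
qed

subsection \<open>Switching a perfect matching along alternating cycles\<close>

text \<open>Take a nonempty invariant subset of least cardinality. Its image is again nonempty and
  invariant, so it cannot be smaller, and \<phi> permutes the subset.\<close>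

lemma finite_self_map_bij_subset:
  assumes "finite T" "T \<noteq> {}" "\<phi> ` T \<subseteq> T"
  obtains C where "C \<subseteq> T" "C \<noteq> {}" "bij_betw \<phi> C C"
proof -
  let ?P = "\<lambda>C. C \<subseteq> T \<and> C \<noteq> {} \<and> \<phi> ` C \<subseteq> C"
  have "?P T"
    using assms by simp
  then obtain C where C: "?P C" and min: "\<And>D. ?P D \<Longrightarrow> card C \<le> card D"
    using ex_has_least_nat[of ?P T card] by blast
  have "finite C"
    using C assms(1) finite_subset by blast
  moreover have "card C \<le> card (\<phi> ` C)"
    using C by (intro min) auto
  ultimately have "\<phi> ` C = C" "inj_on \<phi> C"
    using C card_seteq[of C "\<phi> ` C"] by (simp_all add: eq_card_imp_inj_on)
  then show ?thesis
    using C by (intro that[of C]) (auto simp: bij_betw_def)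
qed

text \<open>The edges \<open>{x, m x}\<close> and \<open>{m x, \<phi> x}\<close> with
  \<open>x\<close> in \<open>C\<close> alternate along the cycles of the permutation \<phi>. All
  these cycles are switched at once, so no single one has to be isolated.\<close>

lemma switched_perfect_matching:
  assumes M: "perfect_matching G M"
    and mate: "\<And>x. x \<in> C \<Longrightarrow> {x, m x} \<in> M"
    and disj: "\<And>x. x \<in> C \<Longrightarrow> m x \<notin> C"
    and bij: "bij_betw \<phi> C C"
    and step: "\<And>x. x \<in> C \<Longrightarrow> m x \<rightarrow>\<^bsub>G\<^esub> \<phi> x \<and> \<phi> x \<noteq> x"
    and "C \<noteq> {}"
  shows "\<exists>M'. perfect_matching G M' \<and> M' \<noteq> M"
proof -
  define M' where "M' = (M - (\<lambda>x. {x, m x}) ` C) \<union> (\<lambda>x. {m x, \<phi> x}) ` C"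
  have same: "e = e'" if "e \<in> M" "e' \<in> M" "v \<in> e" "v \<in> e'" for e e' v
    using M that unfolding perfect_matching_def matching_def pairwise_def disjnt_def by blast
  have \<phi>C: "\<phi> x \<in> C" if "x \<in> C" for x
    using bij that by (auto simp: bij_betw_def)
  have \<phi>_inj: "x = y" if "x \<in> C" "y \<in> C" "\<phi> x = \<phi> y" for x y
    using bij that by (auto simp: bij_betw_def inj_on_def)
  have m_inj: "x = y" if "x \<in> C" "y \<in> C" "m x = m y" for x y
    using same[OF mate[OF that(1)] mate[OF that(2)], of "m x"] that disj by (auto simp: doubleton_eq_iff)
  have old_new: "disjnt e {m x, \<phi> x}" if "e \<in> M - (\<lambda>x. {x, m x}) ` C" "x \<in> C" for e x
  proof -
    have "m y \<notin> e \<and> y \<notin> e" if "y \<in> C" for y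
      using same[OF _ mate[OF that]] that \<open>e \<in> _\<close> by blast
    then show ?thesis
      using \<open>x \<in> C\<close> \<phi>C by (auto simp: disjnt_def)
  qed
  have new_new: "disjnt {m x, \<phi> x} {m y, \<phi> y}" if "x \<in> C" "y \<in> C" "x \<noteq> y" for x y
  proof -
    have "m x \<noteq> m y" "\<phi> x \<noteq> \<phi> y" "m x \<noteq> \<phi> y" "m y \<noteq> \<phi> x"
      using that \<phi>_inj m_inj disj \<phi>C by metis+
    then show ?thesis
      by (auto simp: disjnt_def)
  qed
  have "pairwise disjnt M'"
  proof (rule pairwiseI)
    fix e e' assume e: "e \<in> M'" "e' \<in> M'" "e \<noteq> e'"
    have old_old: "disjnt e e'" if "e \<in> M" "e' \<in> M"
      using same that e(3) unfolding disjnt_def by blast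
    consider "e \<in> M - (\<lambda>x. {x, m x}) ` C" "e' \<in> M - (\<lambda>x. {x, m x}) ` C"
      | x where "e \<in> M - (\<lambda>x. {x, m x}) ` C" "x \<in> C" "e' = {m x, \<phi> x}"
      | x where "e' \<in> M - (\<lambda>x. {x, m x}) ` C" "x \<in> C" "e = {m x, \<phi> x}"
      | x y where "x \<in> C" "e = {m x, \<phi> x}" "y \<in> C" "e' = {m y, \<phi> y}"
      using e(1,2) unfolding M'_def by blast
    then show "disjnt e e'"
    proof cases
      case 1
      then show ?thesis using old_old by blast
    next
      case 2
      then show ?thesis using old_new by simp
    next
      case 3
      then show ?thesis using old_new disjnt_sym by metis
    next
      case 4
      with e(3) have "x \<noteq> y" by blast
      with 4 show ?thesis using new_new by simp
    qed
  qed
  moreover have "M' \<subseteq> edges G"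
    using M step unfolding M'_def perfect_matching_def matching_def edges_def by blast
  moreover have "\<exists>e \<in> M'. v \<in> e" if "v \<in> verts G" for v
  proof -
    from M that have "\<exists>e\<in>M. v \<in> e"
      by (simp add: perfect_matching_def)
    then obtain e where e: "e \<in> M" "v \<in> e" ..
    show ?thesis
    proof (cases "e \<in> (\<lambda>x. {x, m x}) ` C")
      case True
      then obtain x where x: "x \<in> C" "v = x \<or> v = m x"
        using e(2) by blast
      \<comment> \<open>If \<open>v\<close> lies in \<open>C\<close>, surjectivity of \<phi> on
        \<open>C\<close> provides the new edge that covers it; otherwise \<open>v\<close> is a mate
        and keeps its index.\<close>
      then obtain y where "y \<in> C" "v = \<phi> y \<or> v = m y"
        using bij unfolding bij_betw_def by blast
      then show ?thesis
        unfolding M'_def by blast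
    next
      case False
      then show ?thesis
        using e unfolding M'_def by blast
    qed
  qed
  ultimately have "perfect_matching G M'"
    unfolding perfect_matching_def matching_def by blast
  moreover obtain x where x: "x \<in> C"
    using \<open>C \<noteq> {}\<close> by blast
  \<comment> \<open>Both this edge and \<open>{x, m x}\<close> contain \<open>m x\<close>; within a
    matching they would coincide, forcing \<open>\<phi> x = x\<close>.\<close>
  have "{m x, \<phi> x} \<notin> M"
    using same[OF _ mate[OF x], of "{m x, \<phi> x}" "m x"] step[OF x] \<phi>C[OF x] disj[OF x]
    by (auto simp: doubleton_eq_iff)
  then have "M' \<noteq> M"
    using x unfolding M'_def by blast
  ultimately show ?thesis
    by blast
qed

subsection \<open>Coordinate flips\<close>

text \<open>For \<open>i\<close> beyond the length this is the identity, so the involution and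
  commutation laws hold without side conditions.\<close>

definition flip :: "nat \<Rightarrow> bool list \<Rightarrow> bool list" where
  "flip i x = x[i := \<not> x ! i]"

lemma length_flip [simp]: "length (flip i x) = length x"
  by (simp add: flip_def)

lemma flip_flip [simp]: "flip i (flip i x) = x"
  by (cases "i < length x") (simp_all add: flip_def list_update_beyond)

lemma flip_commute: "flip i (flip j x) = flip j (flip i x)"
  by (cases "i = j") (simp_all add: flip_def list_update_swap)

lemma flip_inject: "i < length x \<Longrightarrow> flip i x = flip j x \<Longrightarrow> i = j"
  by (metis flip_def nth_list_update_eq nth_list_update_neq)

text \<open>This parity is the bipartition of the cube.\<close>

lemma even_count_flip:
  "i < length x \<Longrightarrow> even (count_list (flip i x) True) \<longleftrightarrow> odd (count_list x True)"
  unfolding flip_def by (induction x arbitrary: i) (auto simp: nth_Cons split: nat.splits)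

lemma hypercube_dominates_iff:
  "u \<rightarrow>\<^bsub>hypercube n\<^esub> v \<longleftrightarrow> length u = n \<and> (\<exists>i<n. v = flip i u)"
proof -
  have "(length v = n \<and> card {i. i < n \<and> u ! i \<noteq> v ! i} = 1) \<longleftrightarrow> (\<exists>i<n. v = flip i u)"
    if u: "length u = n"
  proof (safe)
    assume v: "n = length v" and "card {i. i < length v \<and> u ! i \<noteq> v ! i} = 1"
    then obtain i where i: "{i. i < length v \<and> u ! i \<noteq> v ! i} = {i}"
      by (auto simp: card_1_singleton_iff)
    then have "i < length v"
      by blast
    have "v ! k = flip i u ! k" if "k < length v" for k
      using i that u v by (cases "k = i") (auto simp: flip_def)
    then have "v = flip i u"
      using u v by (intro nth_equalityI) simp_all
    then show "\<exists>i<length v. v = flip i u"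
      using \<open>i < length v\<close> by blast
  next
    fix i assume "i < n"
    then have "{k. k < n \<and> u ! k \<noteq> flip i u ! k} = {i}"
      using u by (auto simp: flip_def nth_list_update)
    then show "card {k. k < n \<and> u ! k \<noteq> flip i u ! k} = 1"
      by simp
  qed (use u in simp)
  then show ?thesis
    by (auto simp: hypercube_def arcs_ends_conv)
qed

lemma induced_subgraph_dominates_iff:
  assumes "induced_subgraph H G"
  shows "u \<rightarrow>\<^bsub>H\<^esub> v \<longleftrightarrow> u \<in> verts H \<and> v \<in> verts H \<and> u \<rightarrow>\<^bsub>G\<^esub> v"
  using assms by (fastforce simp: induced_subgraph_def subgraph_def compatible_def arcs_ends_conv)

subsection \<open>The weighted adjacency operator of the cube\<close>

definition cube_op :: "nat \<Rightarrow> (nat \<Rightarrow> 'a::comm_ring_1) \<Rightarrow> (bool list \<Rightarrow> 'a) \<Rightarrow> bool list \<Rightarrow> 'a" where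
  "cube_op n w f x = (\<Sum>i<n. w i * f (flip i x))"

lemma cube_op_diff: "cube_op n w (\<lambda>x. f x - g x) x = cube_op n w f x - cube_op n w g x"
  by (simp add: cube_op_def right_diff_distrib sum_subtractf)

lemma cube_op_uminus: "cube_op n w (\<lambda>x. - f x) x = - cube_op n w f x"
  by (simp add: cube_op_def sum_negf)

lemma cube_op_cong:
  assumes "\<And>y. length y = length x \<Longrightarrow> f y = g y"
  shows "cube_op n w f x = cube_op n w g x"
  using assms by (simp add: cube_op_def)

text \<open>The terms at \<open>(i, j)\<close> and \<open>(j, i)\<close> cancel, which leaves the
  diagonal.\<close>

lemma sum_symmetric_char_2:
  fixes h :: "nat \<Rightarrow> nat \<Rightarrow> 'a::comm_ring_1"
  assumes "\<And>x::'a. x + x = 0" "\<And>i j. h i j = h j i"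
  shows "(\<Sum>i<n. \<Sum>j<n. h i j) = (\<Sum>i<n. h i i)"
proof (induction n)
  case (Suc n)
  have "(\<Sum>i<n. h n i) = (\<Sum>i<n. h i n)"
    using assms(2) by simp
  then have "(\<Sum>i<Suc n. \<Sum>j<Suc n. h i j) =
      (\<Sum>i<n. \<Sum>j<n. h i j) + ((\<Sum>i<n. h i n) + (\<Sum>i<n. h i n)) + h n n"
    by (simp add: sum.distrib algebra_simps)
  then show ?case
    by (simp add: Suc assms(1))
qed simp

lemma cube_op_square_zero:
  fixes w :: "nat \<Rightarrow> 'a::comm_ring_1"
  assumes "\<And>x::'a. x + x = 0" "(\<Sum>i<n. w i * w i) = 0"
  shows "cube_op n w (cube_op n w f) x = 0"
proof -
  have "cube_op n w (cube_op n w f) x =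
      (\<Sum>i<n. \<Sum>j<n. w i * w j * f (flip j (flip i x)))"
    by (simp add: cube_op_def sum_distrib_left mult.assoc)
  also have "\<dots> = (\<Sum>i<n. w i * w i * f (flip i (flip i x)))"
    by (rule sum_symmetric_char_2) (simp_all add: assms(1) flip_commute mult.commute)
  also have "\<dots> = 0"
    using assms(2) by (simp flip: sum_distrib_right)
  finally show ?thesis .
qed

text \<open>
  If \<open>f x \<noteq> 0\<close> and \<open>y\<close> is the mate of \<open>x\<close>, then the equation at \<open>y\<close> forces a second
  neighbour of \<open>y\<close> into the support of \<open>f\<close>. Iterating this closes up to an alternating cycle.
\<close>

lemma cube_op_injective_of_unique_matching:
  fixes w :: "nat \<Rightarrow> 'a::idom"
  assumes ind: "induced_subgraph H (hypercube n)"
    and uniq: "\<exists>!M. perfect_matching H M"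
    and w: "\<And>i. w i \<noteq> 0"
    and supp: "\<And>x. x \<notin> verts H \<Longrightarrow> f x = 0"
    and ker: "\<And>x. x \<in> verts H \<Longrightarrow> cube_op n w f x = 0"
  shows "f x = 0"
proof (rule ccontr)
  assume fx: "f x \<noteq> 0"
  obtain M where M: "perfect_matching H M"
    using uniq by blast
  have adj: "u \<rightarrow>\<^bsub>H\<^esub> v \<longleftrightarrow> u \<in> verts H \<and> v \<in> verts H \<and> length u = n \<and> (\<exists>i<n. v = flip i u)" for u v
    using induced_subgraph_dominates_iff[OF ind] hypercube_dominates_iff by auto
  have M_edges: "M \<subseteq> edges H" and M_cover: "\<And>v. v \<in> verts H \<Longrightarrow> \<exists>e\<in>M. v \<in> e"
    using M by (simp_all add: perfect_matching_def matching_def)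
  have adj_sym: "v \<rightarrow>\<^bsub>H\<^esub> u" if "u \<rightarrow>\<^bsub>H\<^esub> v" for u v
    using that unfolding adj by (metis flip_flip length_flip)
  have "\<exists>z. {y, z} \<in> M \<and> y \<rightarrow>\<^bsub>H\<^esub> z" if "y \<in> verts H" for y
  proof -
    obtain e where "e \<in> M" "y \<in> e"
      using M_cover \<open>y \<in> verts H\<close> by blast
    moreover from this obtain u v where "e = {u, v}" "u \<rightarrow>\<^bsub>H\<^esub> v"
      using M_edges unfolding edges_def by blast
    ultimately show ?thesis
      using adj_sym[of u v] by (auto simp: insert_commute)
  qed
  then obtain m where m: "\<And>y. y \<in> verts H \<Longrightarrow> {y, m y} \<in> M \<and> y \<rightarrow>\<^bsub>H\<^esub> m y"
    by metis
  let ?even = "\<lambda>y. even (count_list y True)"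
  \<comment> \<open>Restricting the support of \<open>f\<close> to one class of the bipartition
    keeps the mates of vertices of \<open>T\<close> outside \<open>T\<close>, as switching
    requires.\<close>
  define T where "T = {y \<in> verts H. f y \<noteq> 0 \<and> ?even y = ?even x}"
  have "\<exists>z. z \<in> T \<and> m y \<rightarrow>\<^bsub>H\<^esub> z \<and> z \<noteq> y" if y: "y \<in> T" for y
  proof -
    obtain i where i: "i < n" "m y = flip i y" "length y = n" "m y \<in> verts H"
      using m[of y] y by (auto simp: T_def adj)
    \<comment> \<open>Otherwise the equation at \<open>m y\<close> reduces to
      \<open>w i * f y = 0\<close>, although both factors are nonzero.\<close>
    have "\<exists>j \<in> {..<n} - {i}. w j * f (flip j (m y)) \<noteq> 0"
    proof (rule ccontr)
      assume "\<not> ?thesis"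
      then have "(\<Sum>j \<in> {..<n} - {i}. w j * f (flip j (m y))) = 0"
        by (intro sum.neutral) blast
      then have "cube_op n w f (m y) = w i * f (flip i (m y))"
        using i(1) by (simp add: cube_op_def sum.remove)
      then show False
        using ker[OF i(4)] w[of i] y i(2) by (simp add: T_def)
    qed
    then obtain j where j: "j < n" "j \<noteq> i" "f (flip j (m y)) \<noteq> 0"
      by auto
    then have "flip j (m y) \<in> verts H"
      using supp by blast
    moreover have "?even (flip j (m y)) = ?even y"
      using i j(1) by (simp add: even_count_flip)
    moreover have "flip j (m y) \<noteq> y"
      using flip_inject[of j "m y" i] i j by auto
    ultimately show ?thesis
      using i j y by (intro exI[of _ "flip j (m y)"]) (auto simp: T_def adj)
  qed
  then obtain \<phi> where \<phi>: "\<And>y. y \<in> T \<Longrightarrow> \<phi> y \<in> T \<and> m y \<rightarrow>\<^bsub>H\<^esub> \<phi> y \<and> \<phi> y \<noteq> y"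
    by metis
  have "verts H \<subseteq> {v. length v = n}"
    using ind by (auto simp: induced_subgraph_def subgraph_def hypercube_def)
  then have "finite T"
    using finite_lists_length_eq[of "UNIV :: bool set" n] unfolding T_def
    by (auto intro: finite_subset)
  moreover have "x \<in> T"
    using fx supp by (auto simp: T_def)
  ultimately obtain C where C: "C \<subseteq> T" "C \<noteq> {}" "bij_betw \<phi> C C"
    using \<phi> finite_self_map_bij_subset[of T \<phi>] by blast
  have "m y \<notin> T" if "y \<in> T" for y
    using m[of y] that even_count_flip by (auto simp: T_def adj)
  then have "\<exists>M'. perfect_matching H M' \<and> M' \<noteq> M"
    using M C \<phi> m by (intro switched_perfect_matching[of H M C m \<phi>]) (auto simp: T_def)
  then show False
    using uniq M by blast
qed

section \<open>The dimension count over the field with four elements\<close>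

theorem theorem1:
  fixes n :: nat and H :: "(bool list, bool list \<times> bool list) pre_digraph"
  assumes "n \<ge> 2"
    and "induced_subgraph H (hypercube n)"
    and "\<exists>!M. perfect_matching H M"
  shows "card (verts H) \<le> 2 ^ (n - 1)"
proof -
  obtain w :: "nat \<Rightarrow> F4" where w: "\<And>i. w i \<noteq> 0" "(\<Sum>i<n. w i * w i) = 0"
    using F4_weights_exist[OF assms(1)] by blast
  define S where "S = verts H"
  define V where "V = {v :: bool list. length v = n}"
  \<comment> \<open>Members of \<open>S \<rightarrow>\<^sub>E UNIV\<close> are
    \<open>undefined\<close> outside \<open>S\<close>; \<open>ext\<close> replaces that value by 0.
    Likewise, restricting \<open>\<Phi>\<close> to \<open>V\<close> puts its values into a finite
    function space.\<close>
  define ext where "ext f x = (if x \<in> S then f x else 0)" for f :: "bool list \<Rightarrow> F4" and x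
  define \<Phi> where "\<Phi> = (\<lambda>(f, g). \<lambda>x\<in>V. ext f x + cube_op n w (ext g) x)"
  have inj0: "h x = 0" if "\<And>x. x \<notin> S \<Longrightarrow> h x = 0" "\<And>x. x \<in> S \<Longrightarrow> cube_op n w h x = 0" for h x
    using assms(2,3) w(1) that unfolding S_def by (rule cube_op_injective_of_unique_matching)
  have "S \<subseteq> V"
    using assms(2) by (auto simp: induced_subgraph_def subgraph_def hypercube_def S_def V_def)
  have "finite V" "card V = 2 ^ n"
    using finite_lists_length_eq[of "UNIV :: bool set" n] card_lists_length_eq[of "UNIV :: bool set" n]
    by (simp_all add: V_def)
  then have "finite S"
    using \<open>S \<subseteq> V\<close> finite_subset by blast
  let ?F = "\<lambda>A. A \<rightarrow>\<^sub>E (UNIV :: F4 set)"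
  have "inj_on \<Phi> (?F S \<times> ?F S)"
  proof (rule inj_onI; clarify)
    fix f g f' g'
    assume F: "f \<in> ?F S" "g \<in> ?F S" "f' \<in> ?F S" "g' \<in> ?F S" and eq: "\<Phi> (f, g) = \<Phi> (f', g')"
    define d where "d x = ext f x - ext f' x" for x
    define e where "e x = ext g x - ext g' x" for x
    have de: "d x = - cube_op n w e x" if "x \<in> V" for x
      using fun_cong[OF eq, of x] that
      by (simp add: \<Phi>_def d_def e_def[abs_def] cube_op_diff algebra_simps)
    have "cube_op n w d x = 0" if "x \<in> S" for x
    proof -
      \<comment> \<open>\<open>d = - A e\<close> is known on \<open>V\<close> only; this suffices
        because flips preserve length.\<close>
      have "cube_op n w d x = cube_op n w (\<lambda>y. - cube_op n w e y) x"
        using de that \<open>S \<subseteq> V\<close> by (intro cube_op_cong) (auto simp: V_def)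
      then show ?thesis
        by (simp add: cube_op_uminus cube_op_square_zero F4_add_self w(2))
    qed
    then have d0: "d x = 0" for x
      by (rule inj0[rotated]) (simp_all add: d_def ext_def)
    have "cube_op n w e x = 0" if "x \<in> S" for x
      using de[of x] d0[of x] that \<open>S \<subseteq> V\<close> by auto
    then have e0: "e x = 0" for x
      by (rule inj0[rotated]) (simp_all add: e_def ext_def)
    have "f x = f' x \<and> g x = g' x" if "x \<in> S" for x
      using d0[of x] e0[of x] that by (simp add: d_def e_def ext_def)
    then show "f = f' \<and> g = g'"
      using F by (auto intro: PiE_ext)
  qed
  moreover have "\<Phi> ` (?F S \<times> ?F S) \<subseteq> ?F V"
    by (auto simp: \<Phi>_def)
  moreover have "finite (?F V)"
    using \<open>finite V\<close> by (simp add: finite_PiE)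
  ultimately have "card (?F S \<times> ?F S) \<le> card (?F V)"
    by (rule card_inj_on_le)
  \<comment> \<open>Comparing exponents of 4 plays the part of comparing dimensions.\<close>
  then have "(4::nat) ^ (card S + card S) \<le> 4 ^ card V"
    using \<open>finite S\<close> \<open>finite V\<close> by (simp add: card_cartesian_product card_PiE card_UNIV_F4 power_add)
  then have "card S + card S \<le> 2 ^ n"
    using \<open>card V = 2 ^ n\<close> by simp
  moreover have "(2::nat) ^ n = 2 * 2 ^ (n - 1)"
    using assms(1) by (simp flip: power_Suc)
  ultimately show ?thesis
    unfolding S_def by linarith
qed

end
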